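(* Let $k\geq 2$. For any integers $n_i\geq 2$, $1\leq i\leq k$, there exist DFAs $A_1,\ldots,A_k$ over a common alphabet, where $A_i$ has $n_i$ states, such that any DFA accepting the catenation $L(A_1)L(A_2)\cdots L(A_k)$ needs at least $$n_1 2^{n_2+\cdots+n_k}-D-\sum_{i=1}^{k-1}E_i$$ states, where $D$ and $E_i$ are defined as follows. First, $$D=n_1\sum_{t=2}^{k-1}\Bigl(\prod_{j=2}^{t-1}(2^{n_j}-1)\Bigr)\bigl(2^{n_{t+1}+\cdots+n_k}-1\bigr)$$ (with $D=0$ if $k=2$). Put $N_{k+1}=1$ and $N_j=1+(2^{n_j}-1)N_{j+1}$ for $3\le j\le k$ (so $N_k=2^{n_k}$ when $k\geq 3$), and $T_j=1+(2^{n_j-1}-1)N_{j+1}$ for $2\leq j\leq k$. Put $w_1(0)=n_1-1$, $w_1(1)=1$, and for $2\le j\le k-1$ $$w_j(0,0)=2^{n_j-1}-1,\quad w_j(0,1)=2^{n_j-1},\quad w_j(1,0)=w_j(1,1)=2^{n_j-2}.$$ Then, for $1\leq i\leq k-1$, $$E_i=T_{i+1}\sum_{\substack{(\epsilon_1,\ldots,\epsilon_i)\in\{0,1\}^i\\ \epsilon_i=1}} w_1(\epsilon_1)\prod_{j=2}^{i}w_j(\epsilon_{j-1},\epsilon_j).$$ (For example $E_1=T_2$ and $E_2=\bigl((n_1-1)2^{n_2-1}+2^{n_2-2}\bigr)T_3$.)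
   Context: A DFA is a tuple $(Q,\Sigma,\delta,s,F)$ with $Q$ a finite nonempty set of states, $\Sigma$ a finite nonempty input alphabet, $\delta:Q\times\Sigma\to Q$ the transition function, $s\in Q$ the initial state and $F\subseteq Q$ the set of final states. All DFAs are complete, i.e. $\delta$ is a total function. $L(A)$ is the language accepted by $A$. The catenation of languages is $L_1L_2=\{uv\mid u\in L_1,v\in L_2\}$. Empty sums are $0$ and empty products are $1$. *)

theory Defs
  imports Main "HOL-Library.FuncSet"
begin

record ('q, 'a) dfa =
  states :: "'q set"
  alphabet :: "'a set"
  trans :: "'q \<Rightarrow> 'a \<Rightarrow> 'q"
  initial :: 'q
  final :: "'q set"

text \<open>
  The values of \<^const>\<open>trans\<close> outside \<open>states \<times> alphabet\<close> are irrelevant.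
\<close>

definition is_dfa :: "('q, 'a) dfa \<Rightarrow> bool" where
  "is_dfa A \<longleftrightarrow>
     finite (states A) \<and> states A \<noteq> {} \<and>
     finite (alphabet A) \<and> alphabet A \<noteq> {} \<and>
     (\<forall>q\<in>states A. \<forall>a\<in>alphabet A. trans A q a \<in> states A) \<and>
     initial A \<in> states A \<and>
     final A \<subseteq> states A"

definition accepted_language :: "('q, 'a) dfa \<Rightarrow> 'a list set" where
  "accepted_language A =
     {w \<in> lists (alphabet A). foldl (trans A) (initial A) w \<in> final A}"

text \<open>
  Quantifying over automata whose states are natural numbers covers automata with
  states of any type, up to renaming of states.
\<close>

lemma dfa_nat_states:
  fixes B :: "('q, 'a) dfa"
  assumes "is_dfa B"
  shows "\<exists>B' :: (nat, 'a) dfa. is_dfa B' \<and> alphabet B' = alphabet B \<and>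
           card (states B') = card (states B) \<and> accepted_language B' = accepted_language B"
proof -
  from assms have fin: "finite (states B)" and
    step: "\<And>q a. q \<in> states B \<Longrightarrow> a \<in> alphabet B \<Longrightarrow> trans B q a \<in> states B" and
    ini: "initial B \<in> states B" and fsub: "final B \<subseteq> states B"
    by (auto simp: is_dfa_def)
  from finite_imp_inj_to_nat_seg[OF fin] obtain f :: "'q \<Rightarrow> nat"
    where inj: "inj_on f (states B)" by blast
  define g where "g = inv_into (states B) f"
  have gf: "g (f q) = q" if "q \<in> states B" for q
    using that inj by (simp add: g_def)
  define B' where "B' = \<lparr>states = f ` states B, alphabet = alphabet B,
    trans = (\<lambda>x a. f (trans B (g x) a)), initial = f (initial B), final = f ` final B\<rparr>"
  have run: "foldl (trans B') (f q) w = f (foldl (trans B) q w) \<and>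
             foldl (trans B) q w \<in> states B"
    if "w \<in> lists (alphabet B)" "q \<in> states B" for w q
    using that by (induction w arbitrary: q) (auto simp: B'_def gf step)
  have "foldl (trans B') (initial B') w \<in> final B' \<longleftrightarrow> foldl (trans B) (initial B) w \<in> final B"
    if "w \<in> lists (alphabet B)" for w
  proof -
    have "initial B' = f (initial B)" "final B' = f ` final B"
      by (simp_all add: B'_def)
    then show ?thesis
      using run[OF that ini] inj_on_image_mem_iff[OF inj _ fsub] by simp
  qed
  then have "accepted_language B' = accepted_language B"
    by (auto simp: accepted_language_def B'_def)
  moreover have "is_dfa B'"
    using assms by (auto simp: is_dfa_def B'_def gf)
  moreover have "card (states B') = card (states B)"
    using inj by (simp add: B'_def card_image)
  ultimately show ?thesis
    by (intro exI[of _ B']) (simp add: B'_def)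
qed

definition catenation :: "'a list set \<Rightarrow> 'a list set \<Rightarrow> 'a list set" where
  "catenation L1 L2 = {u @ v | u v. u \<in> L1 \<and> v \<in> L2}"

definition catenation_list :: "'a list set list \<Rightarrow> 'a list set" where
  "catenation_list Ls = foldr catenation Ls {[]}"

text \<open>
  The automaton sizes are \<open>n 1, \<dots>, n k\<close>; all quantities are integers, so that
  subtraction is not truncated. The subtractions inside exponents are on naturals and are
  exact because every \<open>n j\<close> is at least 2.
\<close>

definition D_term :: "nat \<Rightarrow> (nat \<Rightarrow> nat) \<Rightarrow> int" where
  "D_term k n = int (n 1) *
     (\<Sum>t = 2..k - 1. (\<Prod>j = 2..t - 1. 2 ^ n j - 1) * (2 ^ (\<Sum>i = t + 1..k. n i) - 1))"

function N_term :: "nat \<Rightarrow> (nat \<Rightarrow> nat) \<Rightarrow> nat \<Rightarrow> int" where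
  "N_term k n j = (if k < j then 1 else 1 + (2 ^ n j - 1) * N_term k n (j + 1))"
  by pat_completeness auto
termination
  by (relation "measure (\<lambda>(k, n, j). Suc k - j)") auto

declare N_term.simps [simp del]

definition T_term :: "nat \<Rightarrow> (nat \<Rightarrow> nat) \<Rightarrow> nat \<Rightarrow> int" where
  "T_term k n j = 1 + (2 ^ (n j - 1) - 1) * N_term k n (j + 1)"

definition w_first :: "(nat \<Rightarrow> nat) \<Rightarrow> nat \<Rightarrow> int" where
  "w_first n e = (if e = 0 then int (n 1) - 1 else 1)"

definition w_next :: "(nat \<Rightarrow> nat) \<Rightarrow> nat \<Rightarrow> nat \<Rightarrow> nat \<Rightarrow> int" where
  "w_next n j e e' =
     (if e = 0 then (if e' = 0 then 2 ^ (n j - 1) - 1 else 2 ^ (n j - 1))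
      else 2 ^ (n j - 2))"

definition E_term :: "nat \<Rightarrow> (nat \<Rightarrow> nat) \<Rightarrow> nat \<Rightarrow> int" where
  "E_term k n i = T_term k n (i + 1) *
     (\<Sum>\<epsilon> \<in> {\<epsilon> \<in> {1..i} \<rightarrow>\<^sub>E {0, 1}. \<epsilon> i = 1}.
        w_first n (\<epsilon> 1) * (\<Prod>j = 2..i. w_next n j (\<epsilon> (j - 1)) (\<epsilon> j)))"

end

theory Submission
  imports Defs
begin

text \<open>
  Let every tuple of self-maps of the state sets be a letter, with initial state \<open>0\<close> and
  final state \<open>n i - 1\<close>. The subset construction for the catenation yields tuples
  \<open>(P 1, \<dots>, P k)\<close> with \<open>P 1\<close> a singleton, such that an empty component is followed only by
  empty ones and a final state in \<open>P i\<close> forces \<open>0 \<in> P (i + 1)\<close>. With these letters all such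
  tuples are reachable: fill the components one after another by cyclic shifts, then
  collapse each of them onto its target. They are also pairwise inequivalent: a difference in
  component \<open>i\<close> can be moved to component \<open>i + 1\<close> by one letter.

  The admissible tuples with last nonempty component \<open>m\<close> are counted from left to right,
  recording whether component \<open>m\<close> contains its final state; these counts are the path sums
  in \<open>E_term\<close>. In the formula of the theorem, \<open>D_term\<close> removes the tuples in which an empty
  component is followed by a nonempty one, and \<open>E_term k n i\<close> those whose first
  missing initial state is in component \<open>i + 1\<close>.
\<close>

section \<open>Catenations of a list of languages\<close>

lemma catenation_assoc:
  "catenation (catenation K L) M = catenation K (catenation L M)"
  unfolding catenation_def by (auto; metis append.assoc)

lemma catenation_Nil_right [simp]: "catenation L {[]} = L"
  by (auto simp: catenation_def)

lemma catenation_Nil_left [simp]: "catenation {[]} L = L"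
  by (auto simp: catenation_def)

text \<open>The definition peels off the first language, while the subset construction adds automata
  at the right end; associativity reconciles the two.\<close>

lemma catenation_list_snoc:
  "catenation_list (Ls @ [L]) = catenation (catenation_list Ls) L"
proof -
  have "foldr catenation Ls L = catenation (foldr catenation Ls {[]}) L"
    by (induction Ls) (simp_all add: catenation_assoc)
  then show ?thesis by (simp add: catenation_list_def)
qed

section \<open>Counting admissible tuples of subsets\<close>

text \<open>The inner sum of \<open>E_term\<close> with the endpoint \<open>e\<close> left free,
  since the recursion in \<open>i\<close> involves both endpoints.\<close>

definition path_sum :: "(nat \<Rightarrow> nat) \<Rightarrow> nat \<Rightarrow> nat \<Rightarrow> int" where
  "path_sum n i e = (\<Sum>\<epsilon> \<in> {\<epsilon> \<in> {1..i} \<rightarrow>\<^sub>E {0, 1}. \<epsilon> i = e}.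
     w_first n (\<epsilon> 1) * (\<Prod>j = 2..i. w_next n j (\<epsilon> (j - 1)) (\<epsilon> j)))"

lemma E_term_path_sum: "E_term k n i = T_term k n (i + 1) * path_sum n i 1"
  by (simp add: E_term_def path_sum_def)

lemma path_sum_1:
  assumes "e \<in> {0, 1}"
  shows "path_sum n 1 e = w_first n e"
proof -
  have "{\<epsilon> \<in> {1..1::nat} \<rightarrow>\<^sub>E {0, 1::nat}. \<epsilon> 1 = e} = {\<lambda>i. if i = 1 then e else undefined}"
    using assms by (auto simp: PiE_iff extensional_def fun_eq_iff)
  then show ?thesis by (simp add: path_sum_def)
qed

text \<open>A transfer-matrix step: deleting the last entry of a path removes one factor
  \<open>w_next\<close>, which depends only on the last two entries.\<close>

lemma path_sum_Suc:
  assumes "i \<ge> 1" and e': "e' \<in> {0, 1}"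
  shows "path_sum n (Suc i) e' =
    path_sum n i 0 * w_next n (Suc i) 0 e' + path_sum n i 1 * w_next n (Suc i) 1 e'"
proof -
  let ?wt = "\<lambda>i \<epsilon>. w_first n (\<epsilon> 1) * (\<Prod>j = 2..i. w_next n j (\<epsilon> (j - 1)) (\<epsilon> j))"
  let ?P = "{1..i} \<rightarrow>\<^sub>E {0, 1::nat}"
  have fin: "finite ?P" by (intro finite_PiE) auto
  have wt: "?wt (Suc i) (\<epsilon>(Suc i := e')) = ?wt i \<epsilon> * w_next n (Suc i) (\<epsilon> i) e'" for \<epsilon>
  proof -
    have "(\<Prod>j = 2..i. w_next n j ((\<epsilon>(Suc i := e')) (j - 1)) ((\<epsilon>(Suc i := e')) j)) =
      (\<Prod>j = 2..i. w_next n j (\<epsilon> (j - 1)) (\<epsilon> j))"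
      by (rule prod.cong) auto
    moreover have "{2..Suc i} = insert (Suc i) {2..i}" using assms(1) by auto
    ultimately show ?thesis using assms(1) by simp
  qed
  have "path_sum n (Suc i) e' = (\<Sum>\<epsilon>\<in>?P. ?wt i \<epsilon> * w_next n (Suc i) (\<epsilon> i) e')"
    unfolding path_sum_def
  \<comment> \<open>Paths are extensional functions, so shortening one means resetting its last
    entry to \<open>undefined\<close>.\<close>
  proof (rule sum.reindex_bij_witness[where i = "\<lambda>\<epsilon>. \<epsilon>(Suc i := e')"
        and j = "\<lambda>\<epsilon>. \<epsilon>(Suc i := undefined)"], goal_cases)
    case (1 a) then show ?case by auto
  next
    case (2 a) then show ?case
      by (auto simp: PiE_iff extensional_def)
  next
    case (3 b) then show ?case
      by (auto simp: PiE_iff extensional_def fun_eq_iff)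
  next
    case (4 b) then show ?case using e'
      by (auto simp: PiE_iff extensional_def)
  next
    case (5 a)
    have "(a(Suc i := undefined))(Suc i := e') = a" using 5 by auto
    then show ?case using wt[of "a(Suc i := undefined)"] by simp
  qed
  also have "?P = {\<epsilon> \<in> ?P. \<epsilon> i = 0} \<union> {\<epsilon> \<in> ?P. \<epsilon> i = 1}"
  proof -
    have "\<epsilon> i \<in> {0, 1}" if "\<epsilon> \<in> ?P" for \<epsilon>
      using PiE_mem[OF that, of i] assms(1) by simp
    then show ?thesis by blast
  qed
  also have "(\<Sum>\<epsilon>\<in>\<dots>. ?wt i \<epsilon> * w_next n (Suc i) (\<epsilon> i) e') =
     (\<Sum>\<epsilon>\<in>{\<epsilon> \<in> ?P. \<epsilon> i = 0}. ?wt i \<epsilon> * w_next n (Suc i) (\<epsilon> i) e') +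
     (\<Sum>\<epsilon>\<in>{\<epsilon> \<in> ?P. \<epsilon> i = 1}. ?wt i \<epsilon> * w_next n (Suc i) (\<epsilon> i) e')"
    by (rule sum.union_disjoint) (use fin in auto)
  also have "\<dots> = path_sum n i 0 * w_next n (Suc i) 0 e' + path_sum n i 1 * w_next n (Suc i) 1 e'"
    unfolding path_sum_def sum_distrib_right
    by (intro arg_cong2[where f = "(+)"] sum.cong) auto
  finally show ?thesis .
qed

section \<open>Evaluation of the size formula\<close>

lemma N_term_closed:
  assumes "j \<le> Suc k" and "j \<ge> 1"
  shows "N_term k n j = 2 ^ (\<Sum>i = j..k. n i) -
    (\<Sum>t = j..k - 1. (\<Prod>i = j..t - 1. 2 ^ n i - 1) * (2 ^ (\<Sum>i = t + 1..k. n i) - 1))"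
  using assms
proof (induction j rule: inc_induct)
  case base
  then show ?case by (simp add: N_term.simps[of k n "Suc k"])
next
  case (step j)
  let ?s = "\<lambda>t. (2::int) ^ (\<Sum>i = t + 1..k. n i) - 1"
  have jk: "j \<le> k" "1 \<le> j" using step by auto
  have S: "(\<Sum>i = j..k. n i) = n j + (\<Sum>i = Suc j..k. n i)"
    using jk by (simp add: sum.atLeast_Suc_atMost)
  \<comment> \<open>The summand \<open>t = j\<close> has an empty product, and all later ones share
    the factor \<open>2 ^ n j - 1\<close>. For \<open>j = k\<close> both sums are empty and
    \<open>?s k = 0\<close>.\<close>
  have "(\<Sum>t = j..k - 1. (\<Prod>i = j..t - 1. 2 ^ n i - 1) * ?s t) =
    ?s j + (2 ^ n j - 1) * (\<Sum>t = Suc j..k - 1. (\<Prod>i = Suc j..t - 1. 2 ^ n i - 1) * ?s t)"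
  proof (cases "j = k")
    case True
    then show ?thesis using jk by simp
  next
    case False
    then have "j \<le> k - 1" using jk by auto
    then have "(\<Sum>t = j..k - 1. (\<Prod>i = j..t - 1. 2 ^ n i - 1) * ?s t) =
      (\<Prod>i = j..j - 1. 2 ^ n i - 1) * ?s j + (\<Sum>t = Suc j..k - 1. (\<Prod>i = j..t - 1. 2 ^ n i - 1) * ?s t)"
      by (rule sum.atLeast_Suc_atMost)
    moreover have "(\<Prod>i = j..j - 1. (2::int) ^ n i - 1) = 1" using jk by simp
    moreover have "(\<Prod>i = j..t - 1. (2::int) ^ n i - 1) =
        (2 ^ n j - 1) * (\<Prod>i = Suc j..t - 1. 2 ^ n i - 1)" if "t \<in> {Suc j..k - 1}" for t
      by (rule prod.atLeast_Suc_atMost) (use that in auto)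
    ultimately show ?thesis
      by (simp add: sum_distrib_left mult.assoc)
  qed
  moreover have "N_term k n j = 1 + (2 ^ n j - 1) * N_term k n (Suc j)"
    using jk by (simp add: N_term.simps[of k n j])
  ultimately show ?case using step.IH
    by (simp add: S power_add algebra_simps)
qed

text \<open>\<open>N_term k n 2\<close> counts the fillings of components \<open>2\<close> to
  \<open>k\<close> in which an empty component is followed only by empty ones.\<close>

lemma D_term_N_term:
  assumes "k \<ge> 2"
  shows "int (n 1) * 2 ^ (\<Sum>i = 2..k. n i) - D_term k n = int (n 1) * N_term k n 2"
  using N_term_closed[of 2 k n] assms by (simp add: D_term_def right_diff_distrib)

lemma two_power_diff:
  assumes "(2::nat) \<le> m"
  shows "(2::int) ^ m = 4 * 2 ^ (m - 2)" "(2::int) ^ (m - 1) = 2 * 2 ^ (m - 2)"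
proof -
  obtain r where "m = r + 2" using assms by (metis add.commute le_Suc_ex)
  then show "(2::int) ^ m = 4 * 2 ^ (m - 2)" "(2::int) ^ (m - 1) = 2 * 2 ^ (m - 2)"
    by simp_all
qed

text \<open>The right side counts the admissible tuples that end before component \<open>m\<close>,
  plus the admissible beginnings up to \<open>m\<close> continued freely, subject only to the rule
  on empty components. \<open>T_term k n (Suc m)\<close> counts the continuations with
  \<open>0\<close> missing from component \<open>m + 1\<close>, which a final state in component
  \<open>m\<close> forbids.\<close>

lemma size_formula_prefix:
  assumes n2: "\<And>i. i \<in> {1..k} \<Longrightarrow> n i \<ge> 2" and "m \<ge> 1" "m \<le> k"
  shows "int (n 1) * N_term k n 2 - (\<Sum>i = 1..<m. E_term k n i) =
    (\<Sum>i = 1..<m. path_sum n i 0) + (path_sum n m 0 + path_sum n m 1) * N_term k n (Suc m)"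
  using assms(2,3)
proof (induction m rule: dec_induct)
  case base
  have "path_sum n 1 0 + path_sum n 1 1 = int (n 1)"
    using path_sum_1[of 0 n] path_sum_1[of 1 n] by (simp add: w_first_def)
  then show ?case by (simp add: numeral_2_eq_2)
next
  case (step m)
  let ?X = "path_sum n m" and ?N = "N_term k n (Suc (Suc m))"
  have nm: "2 \<le> n (Suc m)" using n2 step by auto
  note pw = two_power_diff[OF nm]
  have X: "path_sum n (Suc m) e = ?X 0 * w_next n (Suc m) 0 e + ?X 1 * w_next n (Suc m) 1 e"
    if "e \<in> {0, 1}" for e
    using path_sum_Suc[OF step(1) that] .
  have N: "N_term k n (Suc m) = 1 + (2 ^ n (Suc m) - 1) * ?N"
    using step by (simp add: N_term.simps[of k n "Suc m"])
  have E: "E_term k n m = (1 + (2 ^ (n (Suc m) - 1) - 1) * ?N) * ?X 1"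
    by (simp add: E_term_path_sum T_term_def)
  \<comment> \<open>On both sides \<open>?X 1\<close> has coefficient
    \<open>2 ^ (n (Suc m) - 1) * ?N\<close>. With \<open>pw\<close> all powers become multiples of
    \<open>2 ^ (n (Suc m) - 2)\<close>, so ring arithmetic suffices.\<close>
  have "(?X 0 + ?X 1) * N_term k n (Suc m) - E_term k n m =
    ?X 0 + (path_sum n (Suc m) 0 + path_sum n (Suc m) 1) * ?N"
    unfolding E N X[of 0, OF insertI1] X[of 1, OF insertI2[OF singletonI]] w_next_def pw
    by (simp add: algebra_simps)
  then show ?case using step by simp
qed

lemma size_formula:
  assumes "k \<ge> 2" and "\<And>i. i \<in> {1..k} \<Longrightarrow> n i \<ge> 2"
  shows "int (n 1) * 2 ^ (\<Sum>i = 2..k. n i) - D_term k n - (\<Sum>i = 1..k - 1. E_term k n i) =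
    (\<Sum>i = 1..<k. path_sum n i 0) + path_sum n k 0 + path_sum n k 1"
proof -
  have "{1..k - 1} = {1..<k}" using assms(1) by auto
  then show ?thesis
    using size_formula_prefix[of k n k] assms D_term_N_term[of k n]
    by (simp add: N_term.simps[of k n "Suc k"])
qed

section \<open>Counting tuples one component at a time\<close>

definition choices :: "(nat \<Rightarrow> nat) \<Rightarrow> nat \<Rightarrow> nat \<Rightarrow> nat \<Rightarrow> nat set set" where
  "choices n j e e' =
     {P. P \<subseteq> {..<n j} \<and> P \<noteq> {} \<and> (e = 1 \<longrightarrow> 0 \<in> P) \<and> (n j - 1 \<in> P \<longleftrightarrow> e' = 1)}"

lemma card_between:
  assumes "finite U" "I \<subseteq> U"
  shows "card {P. I \<subseteq> P \<and> P \<subseteq> U} = 2 ^ (card U - card I)"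
proof -
  have "bij_betw (\<lambda>P. P - I) {P. I \<subseteq> P \<and> P \<subseteq> U} (Pow (U - I))"
    by (rule bij_betw_byWitness[where f' = "\<lambda>P. P \<union> I"]) (use assms in auto)
  then have "card {P. I \<subseteq> P \<and> P \<subseteq> U} = card (Pow (U - I))" by (rule bij_betw_same_card)
  also have "\<dots> = 2 ^ (card U - card I)"
    using assms by (simp add: card_Pow card_Diff_subset finite_subset)
  finally show ?thesis .
qed

text \<open>Since \<open>0\<close> and \<open>n j - 1\<close> are distinct, each membership
  condition fixes one bit of its own. Only for \<open>e = e' = 0\<close> does the empty set have to
  be subtracted.\<close>

lemma card_choices:
  assumes "n j \<ge> 2" "e \<in> {0, 1}" "e' \<in> {0, 1}"
  shows "int (card (choices n j e e')) = w_next n j e e'"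
proof -
  let ?U = "{..<n j}" and ?f = "n j - 1"
  have f: "?f \<in> ?U" "0 \<in> ?U" "?f \<noteq> 0" using assms(1) by auto
  have a: "choices n j 0 0 = {P. {} \<subseteq> P \<and> P \<subseteq> ?U - {?f}} - {{}}"
   and b: "choices n j 0 1 = {P. {?f} \<subseteq> P \<and> P \<subseteq> ?U}"
   and c: "choices n j 1 0 = {P. {0} \<subseteq> P \<and> P \<subseteq> ?U - {?f}}"
   and d: "choices n j 1 1 = {P. {0, ?f} \<subseteq> P \<and> P \<subseteq> ?U}"
    by (auto simp: choices_def)
  have cf: "card (?U - {?f}) = n j - 1" using f by (simp add: card_Diff_singleton_if)
  have "finite {P. {} \<subseteq> P \<and> P \<subseteq> ?U - {?f}}" by simp
  then have "int (card (choices n j 0 0)) = 2 ^ (n j - 1) - 1"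
    unfolding a using card_between[of "?U - {?f}" "{}"] cf
    by (simp add: card_Diff_singleton_if of_nat_diff)
  moreover have "int (card (choices n j 0 1)) = 2 ^ (n j - 1)"
    unfolding b using card_between[of ?U "{?f}"] f by simp
  moreover have "int (card (choices n j 1 0)) = 2 ^ (n j - 2)"
    unfolding c using card_between[of "?U - {?f}" "{0}"] f cf by (simp add: numeral_2_eq_2)
  moreover have "int (card (choices n j 1 1)) = 2 ^ (n j - 2)"
    unfolding d using card_between[of ?U "{0, ?f}"] f by (simp add: numeral_2_eq_2)
  ultimately show ?thesis using assms(2,3) by (auto simp: w_next_def)
qed

text \<open>
  A reachable subset tuple has nonempty components exactly at some indices \<open>1, \<dots>, m\<close>;
  \<open>e\<close> records whether component \<open>m\<close> contains the final state.
\<close>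

definition tuples :: "(nat \<Rightarrow> nat) \<Rightarrow> nat \<Rightarrow> nat \<Rightarrow> (nat \<Rightarrow> nat set) set" where
  "tuples n m e = {T. (\<forall>i. T i \<subseteq> {..<n i}) \<and> (\<forall>i. T i = {} \<longleftrightarrow> i \<notin> {1..m}) \<and>
     card (T 1) = 1 \<and> (\<forall>i\<in>{1..<m}. n i - 1 \<in> T i \<longrightarrow> 0 \<in> T (Suc i)) \<and>
     (n m - 1 \<in> T m \<longleftrightarrow> e = 1)}"

lemma tuples_empty_iff:
  assumes "T \<in> tuples n m e"
  shows "T i = {} \<longleftrightarrow> i \<notin> {1..m}"
  using assms unfolding tuples_def by simp

lemma tuples_1:
  "tuples n 1 e = (\<lambda>q i. if i = 1 then {q} else {}) ` {q. q < n 1 \<and> (q = n 1 - 1 \<longleftrightarrow> e = 1)}"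
  (is "?L = ?R")
proof
  show "?L \<subseteq> ?R"
  proof
    fix T assume T: "T \<in> ?L"
    then obtain q where q: "T 1 = {q}" by (auto simp: tuples_def card_1_singleton_iff)
    moreover have "T i = {}" if "i \<noteq> 1" for i using T that by (auto simp: tuples_def)
    ultimately have "T = (\<lambda>i. if i = 1 then {q} else {})" by (simp add: fun_eq_iff)
    moreover have "q < n 1" "q = n 1 - 1 \<longleftrightarrow> e = 1" using T q by (auto simp: tuples_def)
    ultimately show "T \<in> ?R" by blast
  qed
  show "?R \<subseteq> ?L" by (auto simp: tuples_def split: if_splits)
qed

text \<open>The components up to \<open>m\<close> constrain component \<open>m + 1\<close> only
  through whether component \<open>m\<close> contains its final state.\<close>

lemma tuples_Suc:
  assumes "m \<ge> 1"
  shows "tuples n (Suc m) e' =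
    (\<lambda>(T, P). T(Suc m := P)) ` (tuples n m 0 \<times> choices n (Suc m) 0 e' \<union> tuples n m 1 \<times> choices n (Suc m) 1 e')"
  (is "?L = ?R")
proof
  show "?L \<subseteq> ?R"
  proof
    fix T assume T: "T \<in> ?L"
    define e where "e = (if n m - 1 \<in> T m then 1 else 0 :: nat)"
    have "T(Suc m := {}) \<in> tuples n m e"
      using T assms by (auto simp: tuples_def e_def)
    moreover have "T (Suc m) \<in> choices n (Suc m) e e'"
      using T assms by (auto simp: tuples_def choices_def e_def)
    moreover have "T = (\<lambda>(T, P). T(Suc m := P)) (T(Suc m := {}), T (Suc m))" by simp
    moreover have "e \<in> {0, 1}" by (simp add: e_def)
    ultimately show "T \<in> ?R" by (auto intro!: image_eqI[of _ _ "(T(Suc m := {}), T (Suc m))"])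
  qed
  show "?R \<subseteq> ?L"
  proof
    fix T assume "T \<in> ?R"
    then obtain S P e where e: "e \<in> {0, 1}" and S: "S \<in> tuples n m e"
      and P: "P \<in> choices n (Suc m) e e'" and T: "T = S(Suc m := P)" by auto
    have "n i - 1 \<in> S i \<longrightarrow> 0 \<in> (S(Suc m := P)) (Suc i)" if "i \<in> {1..<Suc m}" for i
      using that S P by (cases "i = m") (auto simp: tuples_def choices_def)
    then show "T \<in> ?L"
      using S P assms unfolding T by (auto simp: tuples_def choices_def)
  qed
qed

text \<open>\<open>tuples_Suc\<close> and \<open>path_sum_Suc\<close> are the same recursion, with
  \<open>card_choices\<close> supplying the weights.\<close>

lemma finite_tuples_and_card:
  assumes "m \<ge> 1" "\<And>i. i \<in> {1..m} \<Longrightarrow> n i \<ge> 2" "e \<in> {0, 1}"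
  shows "finite (tuples n m e) \<and> int (card (tuples n m e)) = path_sum n m e"
  using assms
proof (induction m arbitrary: e rule: dec_induct)
  case base
  have n1: "n 1 \<ge> 2" using base by auto
  let ?Q = "{q. q < n 1 \<and> (q = n 1 - 1 \<longleftrightarrow> e = 1)}"
  have "?Q = (if e = 1 then {n 1 - 1} else {..<n 1 - 1})"
    using n1 by auto
  then have "finite ?Q" "int (card ?Q) = w_first n e"
    using n1 base by (auto simp: w_first_def)
  moreover have "inj_on (\<lambda>q (i::nat). if i = 1 then {q} else {}) ?Q"
  proof (rule inj_onI)
    fix q q' :: nat
    assume "(\<lambda>i::nat. if i = 1 then {q} else {}) = (\<lambda>i. if i = 1 then {q'} else {})"
    from fun_cong[OF this, of 1] show "q = q'" by simp
  qed
  note card_image[OF this]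
  ultimately show ?case
    unfolding tuples_1 path_sum_1[OF base(2)] by simp
next
  case (step m)
  let ?A = "tuples n m 0 \<times> choices n (Suc m) 0 e" and ?B = "tuples n m 1 \<times> choices n (Suc m) 1 e"
  have IH: "finite (tuples n m d)" "int (card (tuples n m d)) = path_sum n m d" if "d \<in> {0, 1}" for d
    using step.IH[OF _ that] step.prems by auto
  have finc: "finite (choices n (Suc m) d e)" for d
    by (rule finite_subset[of _ "Pow {..<n (Suc m)}"]) (auto simp: choices_def)
  have fin: "finite ?A" "finite ?B" using IH finc by auto
  have disj: "?A \<inter> ?B = {}" by (auto simp: tuples_def)
  have "inj_on (\<lambda>(T, P). T(Suc m := P)) (?A \<union> ?B)"
  proof (rule inj_onI, clarify)
    fix T P T' P' assume a: "(T, P) \<in> ?A \<union> ?B" "(T', P') \<in> ?A \<union> ?B"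
      and eq: "T(Suc m := P) = T'(Suc m := P')"
    \<comment> \<open>The overwritten component was empty, so the update loses no
      information.\<close>
    have "T (Suc m) = {}" "T' (Suc m) = {}" using a by (auto simp: tuples_def)
    then have "T i = T' i" for i using fun_cong[OF eq, of i] by (cases "i = Suc m") auto
    then show "T = T' \<and> P = P'" using fun_cong[OF eq, of "Suc m"] by auto
  qed
  then have "card (tuples n (Suc m) e) = card (?A \<union> ?B)"
    using tuples_Suc[OF step(1)] by (simp add: card_image)
  also have "\<dots> = card ?A + card ?B" by (rule card_Un_disjoint[OF fin disj])
  finally have "int (card (tuples n (Suc m) e)) = path_sum n (Suc m) e"
    using IH[of 0] IH[of 1] card_choices[of n "Suc m" _ e] step.prems path_sum_Suc[OF step(1) step.prems(2)]
    by (simp add: card_cartesian_product)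
  moreover have "finite (tuples n (Suc m) e)"
    using tuples_Suc[OF step(1)] fin by simp
  ultimately show ?case by simp
qed

section \<open>Automata with all tuples of transformations as letters\<close>

text \<open>Agreement in \<open>act_all\<close> is required only on actual states, which is why a
  finite alphabet can provide every family of self-maps.\<close>

locale transformation_letters =
  fixes k :: nat and n :: "nat \<Rightarrow> nat" and \<Sigma> :: "nat set" and act :: "nat \<Rightarrow> nat \<Rightarrow> nat \<Rightarrow> nat"
  assumes k2: "k \<ge> 2"
    and n2: "\<And>i. i \<in> {1..k} \<Longrightarrow> n i \<ge> 2"
    and finite_letters: "finite \<Sigma>"
    and act_closed: "\<And>a i x. a \<in> \<Sigma> \<Longrightarrow> i \<in> {1..k} \<Longrightarrow> x < n i \<Longrightarrow> act a i x < n i"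
    and act_all: "\<And>h. (\<And>i x. i \<in> {1..k} \<Longrightarrow> x < n i \<Longrightarrow> h i x < n i) \<Longrightarrow>
      \<exists>a\<in>\<Sigma>. \<forall>i\<in>{1..k}. \<forall>x<n i. act a i x = h i x"
begin

definition A :: "nat \<Rightarrow> (nat, nat) dfa" where
  "A i = \<lparr>states = {..<n i}, alphabet = \<Sigma>, trans = (\<lambda>q a. act a i q), initial = 0,
     final = {n i - 1}\<rparr>"

lemma is_dfa_A:
  assumes "i \<in> {1..k}"
  shows "is_dfa (A i)"
proof -
  have "\<Sigma> \<noteq> {}" using act_all[of "\<lambda>i x. x"] by blast
  then show ?thesis
    using assms n2[OF assms] finite_letters act_closed
    by (auto simp: is_dfa_def A_def lessThan_empty_iff)
qed

definition C :: "nat \<Rightarrow> nat list set" where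
  "C i = catenation_list (map (\<lambda>i. accepted_language (A i)) [1..<i + 1])"

text \<open>Component \<open>i\<close> of the subset tuple reached by a word in the subset construction.\<close>

definition reached :: "nat list \<Rightarrow> nat \<Rightarrow> nat set" where
  "reached w i = {foldl (trans (A i)) 0 v | u v. w = u @ v \<and> u \<in> C (i - 1)}"

lemma C_0 [simp]: "C 0 = {[]}"
  by (simp add: C_def catenation_list_def)

lemma C_Suc: "C (Suc i) = catenation (C i) (accepted_language (A (Suc i)))"
  by (simp add: C_def catenation_list_snoc)

lemma mem_C_iff:
  assumes "w \<in> lists \<Sigma>" "i \<ge> 1"
  shows "w \<in> C i \<longleftrightarrow> n i - 1 \<in> reached w i"
proof -
  obtain j where i: "i = Suc j" using assms(2) by (cases i) auto
  have "v \<in> accepted_language (A i) \<longleftrightarrow> foldl (trans (A i)) 0 v = n i - 1" if "w = u @ v" for u v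
    using assms(1) that by (auto simp: accepted_language_def A_def)
  then show ?thesis
    unfolding i C_Suc catenation_def reached_def diff_Suc_1 mem_Collect_eq by metis
qed

lemma run_less:
  assumes "v \<in> lists \<Sigma>" "i \<in> {1..k}" "q < n i"
  shows "foldl (trans (A i)) q v < n i"
  using assms by (induction v arbitrary: q) (auto simp: A_def act_closed)

lemma reached_subset:
  assumes "w \<in> lists \<Sigma>" "i \<in> {1..k}"
  shows "reached w i \<subseteq> {..<n i}"
proof -
  have "0 < n i" using n2[OF assms(2)] by simp
  then have "foldl (trans (A i)) 0 v < n i" if "w = u @ v" for u v
    using assms run_less[of v i 0] that by simp
  then show ?thesis by (auto simp: reached_def)
qed

text \<open>As \<open>n i \<ge> 2\<close>, the initial state \<open>0\<close> differs from the final
  state \<open>n i - 1\<close>.\<close>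

lemma Nil_notin_C:
  assumes "i \<in> {1..k}"
  shows "[] \<notin> C i"
proof -
  have "reached [] i \<subseteq> {0}" by (auto simp: reached_def)
  then show ?thesis using mem_C_iff[of "[]" i] n2[OF assms] assms by auto
qed

lemma reached_Nil:
  assumes "i \<in> {1..k}"
  shows "reached [] i = (if i = 1 then {0} else {})"
proof (cases "i = 1")
  case True
  then show ?thesis by (auto simp: reached_def)
next
  case False
  then have "[] \<notin> C (i - 1)" using assms by (intro Nil_notin_C) auto
  then show ?thesis using False by (auto simp: reached_def)
qed

text \<open>In a split of \<open>w @ [a]\<close> the second part either ends in \<open>a\<close>,
  prolonging an old run, or is empty, which starts a new run. The latter depends on component
  \<open>i - 1\<close> after the letter, so the new components are determined from left to
  right.\<close>

lemma reached_snoc: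
  assumes "w \<in> lists \<Sigma>" "a \<in> \<Sigma>" "i \<ge> 1"
  shows "reached (w @ [a]) i = act a i ` reached w i \<union>
    (if 1 < i \<and> n (i - 1) - 1 \<in> reached (w @ [a]) (i - 1) then {0} else {})"
proof -
  have "reached (w @ [a]) i = act a i ` reached w i \<union> (if w @ [a] \<in> C (i - 1) then {0} else {})"
    (is "?L = ?R")
  proof
    show "?L \<subseteq> ?R"
    proof
      fix p assume "p \<in> ?L"
      then obtain u v where uv: "w @ [a] = u @ v" "u \<in> C (i - 1)" "p = foldl (trans (A i)) 0 v"
        by (auto simp: reached_def)
      show "p \<in> ?R"
      proof (cases v rule: rev_cases)
        case Nil
        then show ?thesis using uv by simp
      next
        case (snoc v' b)
        then have "w = u @ v'" "b = a" using uv(1) by auto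
        then have "foldl (trans (A i)) 0 v' \<in> reached w i" using uv(2) by (auto simp: reached_def)
        then show ?thesis using uv(3) snoc \<open>b = a\<close> by (auto simp: A_def)
      qed
    qed
    show "?R \<subseteq> ?L"
    proof
      fix p assume p: "p \<in> ?R"
      show "p \<in> ?L"
      proof (cases "p \<in> act a i ` reached w i")
        case True
        then obtain u v where uv: "w = u @ v" "u \<in> C (i - 1)" "p = act a i (foldl (trans (A i)) 0 v)"
          by (auto simp: reached_def)
        then have "w @ [a] = u @ (v @ [a])" "p = foldl (trans (A i)) 0 (v @ [a])"
          by (auto simp: A_def)
        then show ?thesis using uv(2) unfolding reached_def by blast
      next
        case False
        then have "w @ [a] \<in> C (i - 1)" "p = 0" using p by (auto split: if_splits)
        then show ?thesis unfolding reached_def by force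
      qed
    qed
  qed
  moreover have "w @ [a] \<in> C (i - 1) \<longleftrightarrow> 1 < i \<and> n (i - 1) - 1 \<in> reached (w @ [a]) (i - 1)"
    using mem_C_iff[of "w @ [a]" "i - 1"] assms by (cases "i = 1") auto
  ultimately show ?thesis by simp
qed

subsection \<open>Reachability\<close>

definition reachable :: "(nat \<Rightarrow> nat set) \<Rightarrow> bool" where
  "reachable S \<longleftrightarrow> (\<exists>w\<in>lists \<Sigma>. \<forall>i\<in>{1..k}. reached w i = S i)"

text \<open>The equation for \<open>S' i\<close> refers to \<open>S' (i - 1)\<close>; strong
  induction on \<open>i\<close> identifies its solution with the tuple reached by one more
  letter.\<close>

lemma reachable_step:
  assumes "reachable S"
    and h: "\<And>i x. i \<in> {1..k} \<Longrightarrow> x < n i \<Longrightarrow> h i x < n i"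
    and S': "\<And>i. i \<in> {1..k} \<Longrightarrow> S' i = h i ` S i \<union>
      (if 1 < i \<and> n (i - 1) - 1 \<in> S' (i - 1) then {0} else {})"
  shows "reachable S'"
proof -
  obtain w where w: "w \<in> lists \<Sigma>" "\<And>i. i \<in> {1..k} \<Longrightarrow> reached w i = S i"
    using assms(1) unfolding reachable_def by blast
  obtain a where a: "a \<in> \<Sigma>" "\<And>i x. i \<in> {1..k} \<Longrightarrow> x < n i \<Longrightarrow> act a i x = h i x"
    using act_all[of h] h by blast
  have "reached (w @ [a]) i = S' i" if "i \<ge> 1" "i \<le> k" for i
    using that
  proof (induction i rule: less_induct)
    case (less i)
    then have ik: "i \<in> {1..k}" by auto
    have "act a i ` reached w i = h i ` S i"
      using reached_subset[OF w(1) ik] a(2)[OF ik] w(2)[OF ik] by (intro image_cong) auto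
    moreover have "reached (w @ [a]) (i - 1) = S' (i - 1)" if "1 < i"
      using less that by auto
    ultimately show ?case
      using reached_snoc[OF w(1) a(1) less.prems(1)] S'[OF ik] by auto
  qed
  then show ?thesis using w(1) a(1) by (auto simp: reachable_def intro!: bexI[of _ "w @ [a]"])
qed

text \<open>
  Since \<open>T\<close> already contains the initial states forced by its final states, no
  component gains an element that is not in the image.
\<close>

lemma reachable_collapse:
  assumes S: "reachable S"
    and Sn: "\<And>i. i \<in> {1..k} \<Longrightarrow> S i \<subseteq> {..<n i}"
    and Tn: "\<And>i. i \<in> {1..k} \<Longrightarrow> T i \<subseteq> {..<n i}"
    and card: "\<And>i. i \<in> {1..k} \<Longrightarrow> card (T i) \<le> card (S i)"
    and empty: "\<And>i. i \<in> {1..k} \<Longrightarrow> T i = {} \<Longrightarrow> S i = {}"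
    and closed: "\<And>i. i \<in> {1..<k} \<Longrightarrow> n i - 1 \<in> T i \<Longrightarrow> 0 \<in> T (Suc i)"
  shows "reachable T"
proof -
  have "\<exists>h. h ` S i = T i \<and> (\<forall>x<n i. h x < n i)" if i: "i \<in> {1..k}" for i
  proof (cases "T i = {}")
    case True
    then show ?thesis using empty[OF i] by (intro exI[of _ id]) auto
  next
    case False
    have fin: "finite (S i)" "finite (T i)"
      using finite_subset[OF Sn[OF i]] finite_subset[OF Tn[OF i]] by simp_all
    obtain f where f: "f ` T i \<subseteq> S i" "inj_on f (T i)"
      using card_le_inj[OF fin(2,1) card[OF i]] by auto
    obtain t where t: "t \<in> T i" using False by auto
    \<comment> \<open>A left inverse of the injection \<open>f\<close>, with default value
      \<open>t\<close> in \<open>T i\<close>; it maps \<open>S i\<close> onto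
      \<open>T i\<close>.\<close>
    define h where "h = (\<lambda>x. if x \<in> f ` T i then inv_into (T i) f x else t)"
    have hT: "h x \<in> T i" for x using t by (auto simp: h_def inv_into_into)
    moreover have "y \<in> h ` S i" if "y \<in> T i" for y
      using f that by (intro image_eqI[of _ _ "f y"]) (auto simp: h_def)
    ultimately have "h ` S i = T i" by auto
    then show ?thesis using hT Tn[OF i] by blast
  qed
  then have "\<forall>i\<in>{1..k}. \<exists>h. h ` S i = T i \<and> (\<forall>x<n i. h x < n i)" by (rule ballI)
  from bchoice[OF this] have "\<exists>h. \<forall>i\<in>{1..k}. h i ` S i = T i \<and> (\<forall>x<n i. h i x < n i)" .
  then obtain h where "\<forall>i\<in>{1..k}. h i ` S i = T i \<and> (\<forall>x<n i. h i x < n i)" ..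
  then have h: "\<And>i. i \<in> {1..k} \<Longrightarrow> h i ` S i = T i"
    "\<And>i x. i \<in> {1..k} \<Longrightarrow> x < n i \<Longrightarrow> h i x < n i"
    by simp_all
  have "0 \<in> T i" if "i \<in> {1..k}" "1 < i" "n (i - 1) - 1 \<in> T (i - 1)" for i
  proof -
    have "i - 1 \<in> {1..<k}" "Suc (i - 1) = i" using that by auto
    then show ?thesis using closed[of "i - 1"] that(3) by simp
  qed
  then show ?thesis
    using h by (intro reachable_step[OF S, of h]) (simp_all add: insert_absorb)
qed

text \<open>Stages of the filling. Component \<open>1\<close> has to stay a singleton, so it waits
  in its final state; thus every component before \<open>m\<close> supplies \<open>0\<close> to its
  successor at each letter.\<close>

definition chain :: "nat \<Rightarrow> nat \<Rightarrow> nat \<Rightarrow> nat set" where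
  "chain m j i = (if i = 1 then {n 1 - 1} else if i < m then {..<n i}
     else if i = m then {..<j} else {})"

text \<open>
  A cyclic shift of component \<open>m\<close>, where the full component \<open>m - 1\<close> keeps supplying the
  initial state, enlarges an initial segment by one; completing the segment starts the
  next component.
\<close>

lemma chain_step:
  assumes "reachable (chain m j)" "2 \<le> m" "m \<le> k" "1 \<le> j" "j < n m"
  shows "reachable (if Suc j = n m \<and> m < k then chain (Suc m) 1 else chain m (Suc j))"
proof (rule reachable_step[OF assms(1), of "\<lambda>i x. if i = m then Suc x mod n m else x"], goal_cases)
  case (1 i x)
  then show ?case by auto
next
  case (2 i)
  \<comment> \<open>As \<open>j < n m\<close>, the shift does not wrap around: it yields
    \<open>1\<close> to \<open>j\<close>, and the supplied \<open>0\<close> completes the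
    segment.\<close>
  have shift: "(\<lambda>x. Suc x mod n m) ` {..<j} \<union> {0} = {..<Suc j}"
  proof -
    have "(\<lambda>x. Suc x mod n m) ` {..<j} = Suc ` {..<j}"
      using assms by (intro image_cong) auto
    then show ?thesis by (simp add: lessThan_Suc_eq_insert_0)
  qed
  have n_pred: "n (i - 1) - 1 \<in> {..<n (i - 1)}" if "1 < i"
  proof -
    have "i - 1 \<in> {1..k}" using 2 that by auto
    then show ?thesis using n2[of "i - 1"] by simp
  qed
  consider "i = 1" | "1 < i" "i < m" | "i = m" | "i = Suc m" | "i > Suc m" using 2 by force
  then show ?case
  proof cases
    case 1
    then show ?thesis using assms by (auto simp: chain_def)
  next
    case 2
    then have "0 \<in> {..<n i}" using n2[of i] assms by auto
    then show ?thesis using 2 assms n_pred by (auto simp: chain_def)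
  next
    case 3
    let ?S' = "if Suc j = n m \<and> m < k then chain (Suc m) 1 else chain m (Suc j)"
    have "?S' m = {..<Suc j}" using assms by (auto simp: chain_def)
    moreover have "n (m - 1) - 1 \<in> ?S' (m - 1)"
      using assms n_pred 3 by (cases "m = 2") (auto simp: chain_def)
    moreover have "chain m j m = {..<j}" using assms by (auto simp: chain_def)
    ultimately show ?thesis using 3 shift assms(2) by simp
  next
    \<comment> \<open>The next component starts exactly when \<open>n m - 1\<close> lies in
      \<open>{..<Suc j}\<close>, that is, when \<open>Suc j = n m\<close>.\<close>
    case 4
    then show ?thesis using assms 2 by (auto simp: chain_def)
  next
    case 5
    then have "i - 1 \<in> {1..k}" using 2 by auto
    then have "n (i - 1) \<ge> 2" by (rule n2)
    then show ?thesis using 5 assms by (auto simp: chain_def)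
  qed
qed

lemma reachable_Nil: "reachable (\<lambda>i. if i = 1 then {0} else {})"
  unfolding reachable_def using reached_Nil by (intro bexI[of _ "[]"]) auto

text \<open>Sending all states to the final ones puts \<open>0\<close> into component
  \<open>2\<close>; since \<open>0\<close> is not final there, component \<open>3\<close> stays
  empty.\<close>

lemma reachable_chain_start: "reachable (chain 2 1)"
proof (rule reachable_step[OF reachable_Nil, of "\<lambda>i x. n i - 1"], goal_cases)
  case (1 i x)
  then show ?case by auto
next
  case (2 i)
  have f: "n 2 - 1 \<notin> {..<1}" using n2[of 2] k2 by auto
  consider "i = 1" | "i = 2" | "i = 3" | "i > 3" using 2 by force
  then show ?case
  proof cases
    case 3
    then show ?thesis using f by (simp add: chain_def)
  qed (auto simp: chain_def)
qed

text \<open>Inner induction lengthens the segment, outer induction moves to the next component. A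
  full component \<open>m\<close> is allowed only for \<open>m = k\<close>, as otherwise component
  \<open>m + 1\<close> has already received \<open>0\<close>.\<close>

lemma reachable_chain:
  assumes "2 \<le> m" "m \<le> k" "1 \<le> j" "j < n m \<or> m = k \<and> j \<le> n m"
  shows "reachable (chain m j)"
  using assms
proof (induction m arbitrary: j rule: dec_induct)
  case base
  show ?case using base(2-)
  proof (induction j rule: dec_induct)
    case base
    then show ?case using reachable_chain_start by simp
  next
    case (step j)
    then show ?case using chain_step[of 2 j] k2 by (auto split: if_splits)
  qed
next
  case (step m)
  have start: "reachable (chain (Suc m) 1)"
  proof -
    have "n m \<ge> 2" using n2[of m] step by auto
    then show ?thesis
      using chain_step[of m "n m - 1"] step.IH[of "n m - 1"] step by (auto split: if_splits)
  qed
  show ?case using step.prems(2,3)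
  proof (induction j rule: dec_induct)
    case base
    then show ?case using start by simp
  next
    case (step j)
    then show ?case using chain_step[of "Suc m" j] \<open>2 \<le> m\<close> \<open>Suc m \<le> k\<close>
      by (auto split: if_splits)
  qed
qed

text \<open>Collapse the start tuple if \<open>m = 1\<close>, and otherwise the chain with
  \<open>card (T m)\<close> elements in component \<open>m\<close>. For \<open>m < k\<close> the
  final state is missing from \<open>T m\<close>, so this cardinality is below \<open>n m\<close>
  and the chain is reachable.\<close>

lemma reachable_tuples:
  assumes T: "T \<in> tuples n m e" and m: "1 \<le> m" "m \<le> k" and e: "m < k \<longrightarrow> e \<noteq> 1"
  shows "reachable T"
proof -
  have Tn: "T i \<subseteq> {..<n i}" and Te: "T i = {} \<longleftrightarrow> i \<notin> {1..m}" for i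
    using T by (auto simp: tuples_def)
  have T1: "card (T 1) = 1" using T by (auto simp: tuples_def)
  have fin: "finite (T i)" for i using finite_subset[OF Tn[of i]] by simp
  have closed: "0 \<in> T (Suc i)" if "i \<in> {1..<k}" "n i - 1 \<in> T i" for i
  proof -
    have "i \<in> {1..m}" using Te[of i] that by blast
    moreover have "i \<noteq> m" using T e that by (auto simp: tuples_def)
    ultimately show ?thesis using T that by (auto simp: tuples_def)
  qed
  show ?thesis
  proof (cases "m = 1")
    case True
    let ?S = "\<lambda>i::nat. if i = 1 then {0::nat} else {}"
    have "?S i \<subseteq> {..<n i}" if "i \<in> {1..k}" for i using n2[OF that] by auto
    moreover have "card (T i) \<le> card (?S i)" for i
      using Te[of i] T1 True by (cases "i = 1") auto
    moreover have "?S i = {}" if "i \<in> {1..k}" "T i = {}" for i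
      using that Te[of i] True by auto
    ultimately show ?thesis
      using closed by (intro reachable_collapse[OF reachable_Nil _ Tn]) blast+
  next
    case False
    then have m2: "2 \<le> m" using m by auto
    have Tm: "card (T m) \<le> n m" "1 \<le> card (T m)"
      using card_mono[OF _ Tn[of m]] Te[of m] m fin[of m] by (auto simp: card_gt_0_iff Suc_le_eq)
    have Tm': "card (T m) < n m" if "m < k"
    proof -
      have "n m - 1 \<notin> T m" "n m \<ge> 2" using T e that n2[of m] m by (auto simp: tuples_def)
      then have "T m \<subset> {..<n m}" using Tn[of m] by (intro psubsetI) auto
      then show ?thesis using psubset_card_mono[of "{..<n m}" "T m"] by simp
    qed
    let ?S = "chain m (card (T m))"
    have S: "reachable ?S"
      using reachable_chain[OF m2 m(2) Tm(2)] Tm(1) Tm' m(2) by (cases "m < k") auto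
    have "?S i \<subseteq> {..<n i}" if "i \<in> {1..k}" for i
      using n2[OF that] Tm(1) by (auto simp: chain_def)
    moreover have "card (T i) \<le> card (?S i)" for i
      using Te[of i] T1 card_mono[OF _ Tn[of i]] m2 by (auto simp: chain_def)
    moreover have "?S i = {}" if "i \<in> {1..k}" "T i = {}" for i
      using that Te[of i] m2 by (auto simp: chain_def)
    ultimately show ?thesis
      using closed by (intro reachable_collapse[OF S _ Tn]) blast+
  qed
qed

subsection \<open>Distinguishability\<close>

text \<open>
  The letter sends \<open>p\<close> to the final state of component \<open>j\<close> and keeps the initial state of
  component \<open>j + 1\<close> out of the image, so a difference in component \<open>j\<close> moves to \<open>j + 1\<close>.
\<close>

lemma distinguishable:
  assumes "w \<in> lists \<Sigma>" "w' \<in> lists \<Sigma>" "1 \<le> j" "j \<le> k" "p \<in> reached w j" "p \<notin> reached w' j"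
  shows "\<exists>v\<in>lists \<Sigma>. w @ v \<in> C k \<and> w' @ v \<notin> C k"
  using assms(4,3,1,2,5,6)
proof (induction j arbitrary: w w' p rule: inc_induct)
  case base
  show ?case
  proof -
    \<comment> \<open>In the last component, one letter making \<open>p\<close> final and all other
      states initial decides acceptance.\<close>
    obtain a where a: "a \<in> \<Sigma>"
      "\<And>i x. i \<in> {1..k} \<Longrightarrow> x < n i \<Longrightarrow> act a i x = (if x = p then n i - 1 else 0)"
      using act_all[of "\<lambda>i x. if x = p then n i - 1 else 0"] by fastforce
    have k: "k \<in> {1..k}" using k2 by auto
    have f: "n k - 1 \<noteq> 0" using n2[OF k] by auto
    have "n k - 1 \<in> reached (w @ [a]) k"
      using reached_snoc[OF base(2) a(1), of k] reached_subset[OF base(2) k] base(4) a(2)[OF k, of p] k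
      by (auto intro!: image_eqI[of _ _ p])
    moreover have "n k - 1 \<notin> reached (w' @ [a]) k"
      using reached_snoc[OF base(3) a(1), of k] reached_subset[OF base(3) k] base(5) a(2)[OF k] k f
      by (auto split: if_splits)
    ultimately show ?thesis
      using mem_C_iff[of "w @ [a]" k] mem_C_iff[of "w' @ [a]" k] base a(1) k2
      by (intro bexI[of _ "[a]"]) auto
  qed
next
  case (step j)
  have j: "j \<in> {1..k}" "Suc j \<in> {1..k}" using step by auto
  define h where "h = (\<lambda>i x. if i = Suc j \<or> x = p then n i - 1 else 0)"
  obtain a where a: "a \<in> \<Sigma>" "\<And>i x. i \<in> {1..k} \<Longrightarrow> x < n i \<Longrightarrow> act a i x = h i x"
    using act_all[of h] by (fastforce simp: h_def)
  have f: "n j - 1 \<noteq> 0" "n (Suc j) - 1 \<noteq> 0" using n2[OF j(1)] n2[OF j(2)] by auto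
  have wa: "w @ [a] \<in> lists \<Sigma>" "w' @ [a] \<in> lists \<Sigma>" using step a by auto
  have "n j - 1 \<in> reached (w @ [a]) j"
    using reached_snoc[OF step.prems(2) a(1), of j] reached_subset[OF step.prems(2) j(1)]
      step.prems(4) a(2)[OF j(1), of p] j
    by (auto simp: h_def intro!: image_eqI[of _ _ p])
  then have "0 \<in> reached (w @ [a]) (Suc j)"
    using reached_snoc[OF step.prems(2) a(1), of "Suc j"] j by auto
  moreover have "n j - 1 \<notin> reached (w' @ [a]) j"
    using reached_snoc[OF step.prems(3) a(1), of j] reached_subset[OF step.prems(3) j(1)]
      step.prems(5) a(2)[OF j(1)] j f
    by (auto simp: h_def split: if_splits)
  then have "0 \<notin> reached (w' @ [a]) (Suc j)"
    using reached_snoc[OF step.prems(3) a(1), of "Suc j"] reached_subset[OF step.prems(3) j(2)]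
      a(2)[OF j(2)] j f
    by (auto simp: h_def)
  ultimately obtain v where "v \<in> lists \<Sigma>" "(w @ [a]) @ v \<in> C k" "(w' @ [a]) @ v \<notin> C k"
    using step.IH[OF _ wa] by auto
  then show ?case using a(1) by (intro bexI[of _ "a # v"]) auto
qed

section \<open>From distinguishability to the number of states\<close>

lemma extends_into_C:
  assumes w: "w \<in> lists \<Sigma>"
  shows "\<exists>v\<in>lists \<Sigma>. w @ v \<in> C k"
proof -
  obtain p where p: "p \<in> reached w 1" by (auto simp: reached_def)
  \<comment> \<open>Component \<open>1\<close> is \<open>{0}\<close> in the start tuple and
    \<open>{n 1 - 1}\<close> in \<open>chain 2 1\<close>, so one of them avoids \<open>p\<close>.
    Distinguishing \<open>w\<close> from a word for that tuple yields the extension.\<close>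
  obtain S where S: "reachable S" "p \<notin> S 1"
  proof (cases "p = 0")
    case True
    then have "p \<notin> chain 2 1 1" using n2[of 1] k2 by (auto simp: chain_def)
    then show ?thesis using that reachable_chain_start by blast
  next
    case False
    then show ?thesis using that reachable_Nil by simp
  qed
  moreover have "1 \<in> {1..k}" using k2 by simp
  ultimately obtain w' where "w' \<in> lists \<Sigma>" "p \<notin> reached w' 1"
    unfolding reachable_def by metis
  then show ?thesis using distinguishable[of w w' 1 p] w p k2 by auto
qed

text \<open>The Myhill-Nerode argument: words for distinct tuples in \<open>V\<close> lead
  \<open>B\<close> to distinct states. Emptiness outside \<open>{1..k}\<close> turns equal
  components into equal functions.\<close>

lemma card_states_ge:
  assumes B: "is_dfa B" and LB: "accepted_language B = C k"
    and V: "\<And>T. T \<in> V \<Longrightarrow> reachable T" "\<And>T i. T \<in> V \<Longrightarrow> i \<notin> {1..k} \<Longrightarrow> T i = {}"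
  shows "card V \<le> card (states B)"
proof -
  \<comment> \<open>The alphabet of \<open>B\<close> is not prescribed, but each letter of
    \<open>\<Sigma>\<close> begins an accepted word and hence belongs to it.\<close>
  have letters: "\<Sigma> \<subseteq> alphabet B"
  proof
    fix a assume "a \<in> \<Sigma>"
    then obtain v where "[a] @ v \<in> accepted_language B"
      using extends_into_C[of "[a]"] LB by auto
    then show "a \<in> alphabet B" by (auto simp: accepted_language_def)
  qed
  define run where "run = foldl (trans B) (initial B)"
  have run: "run w \<in> states B" if "w \<in> lists \<Sigma>" for w
    using that B letters unfolding run_def
    by (induction w rule: rev_induct) (auto simp: is_dfa_def)
  obtain wd where wd: "\<And>T. T \<in> V \<Longrightarrow> wd T \<in> lists \<Sigma>"
    "\<And>T i. T \<in> V \<Longrightarrow> i \<in> {1..k} \<Longrightarrow> reached (wd T) i = T i"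
    using V(1) unfolding reachable_def by metis
  have sub: "T i \<subseteq> T' i"
    if TV: "T \<in> V" "T' \<in> V" and i: "i \<in> {1..k}" and eq: "run (wd T) = run (wd T')" for T T' i
  proof
    fix p assume p: "p \<in> T i"
    show "p \<in> T' i"
    proof (rule ccontr)
      assume "p \<notin> T' i"
      then obtain v where v: "v \<in> lists \<Sigma>" "wd T @ v \<in> C k" "wd T' @ v \<notin> C k"
        using distinguishable[of "wd T" "wd T'" i p] wd TV i p by auto
      have "wd T' @ v \<in> lists (alphabet B)"
        using wd(1)[OF TV(2)] v(1) lists_mono[OF letters] by auto
      then show False
        using v eq unfolding LB[symmetric] accepted_language_def run_def by auto
    qed
  qed
  have "inj_on (\<lambda>T. run (wd T)) V"
  proof (rule inj_onI, rule ext)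
    fix T T' i assume "T \<in> V" "T' \<in> V" "run (wd T) = run (wd T')"
    then show "T i = T' i"
      using sub[of T T' i] sub[of T' T i] V(2) by (cases "i \<in> {1..k}") auto
  qed
  moreover have "(\<lambda>T. run (wd T)) ` V \<subseteq> states B" using wd(1) run by auto
  moreover have "finite (states B)" using B by (simp add: is_dfa_def)
  ultimately show ?thesis by (rule card_inj_on_le)
qed

text \<open>For \<open>m < k\<close> only \<open>e = 0\<close> occurs, since a final state in
  component \<open>m\<close> makes component \<open>m + 1\<close> nonempty. The families are
  disjoint because the nonempty components determine \<open>m\<close>.\<close>

lemma states_lower_bound:
  assumes "is_dfa B" "accepted_language B = C k"
  shows "int (card (states B)) \<ge>
    int (n 1) * 2 ^ (\<Sum>i = 2..k. n i) - D_term k n - (\<Sum>i = 1..k - 1. E_term k n i)"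
proof -
  let ?I = "\<Union>m\<in>{1..<k}. tuples n m 0"
  let ?V = "?I \<union> (tuples n k 0 \<union> tuples n k 1)"
  have fc: "finite (tuples n m e)" "int (card (tuples n m e)) = path_sum n m e"
    if "m \<in> {1..k}" "e \<in> {0, 1}" for m e
    using finite_tuples_and_card[of m n e] n2 that by auto
  have support: "m = m'" if "T \<in> tuples n m e" "T \<in> tuples n m' e'" "m \<ge> 1" "m' \<ge> 1" for T m m' e e'
  proof (rule antisym)
    have "i \<in> {1..m} \<longleftrightarrow> i \<in> {1..m'}" for i
      using tuples_empty_iff[OF that(1), of i] tuples_empty_iff[OF that(2), of i] by blast
    from this[of m] this[of m'] show "m \<le> m'" "m' \<le> m" using that(3,4) by auto
  qed
  have "int (card ?I) = (\<Sum>m = 1..<k. int (card (tuples n m 0)))"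
  proof (subst card_UN_disjoint)
    show "\<forall>m\<in>{1..<k}. \<forall>m'\<in>{1..<k}. m \<noteq> m' \<longrightarrow> tuples n m 0 \<inter> tuples n m' 0 = {}"
    proof (intro ballI impI equals0I)
      fix m m' T assume "m \<in> {1..<k}" "m' \<in> {1..<k}" "m \<noteq> m'" "T \<in> tuples n m 0 \<inter> tuples n m' 0"
      then show False using support[of T m 0 m' 0] by simp
    qed
  qed (use fc in auto)
  also have "\<dots> = (\<Sum>m = 1..<k. path_sum n m 0)"
    by (rule sum.cong) (use fc in auto)
  finally have I: "int (card ?I) = (\<Sum>m = 1..<k. path_sum n m 0)" .
  have "card (tuples n k 0 \<union> tuples n k 1) = card (tuples n k 0) + card (tuples n k 1)"
  proof (rule card_Un_disjoint)
    show "tuples n k 0 \<inter> tuples n k 1 = {}" by (auto simp: tuples_def)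
  qed (use fc k2 in auto)
  moreover have "card ?V = card ?I + card (tuples n k 0 \<union> tuples n k 1)"
  proof (rule card_Un_disjoint)
    show "?I \<inter> (tuples n k 0 \<union> tuples n k 1) = {}"
    proof (rule equals0I)
      fix T assume "T \<in> ?I \<inter> (tuples n k 0 \<union> tuples n k 1)"
      then obtain m e where "m \<in> {1..<k}" "T \<in> tuples n m 0" "T \<in> tuples n k e" by auto
      then show False using support[of T m 0 k e] by simp
    qed
  qed (use fc k2 in auto)
  ultimately have "int (card ?V) =
    int (n 1) * 2 ^ (\<Sum>i = 2..k. n i) - D_term k n - (\<Sum>i = 1..k - 1. E_term k n i)"
    using size_formula[of k n, OF k2 n2] fc[of k 0] fc[of k 1] I k2 by simp
  moreover have "card ?V \<le> card (states B)"
  proof (rule card_states_ge[OF assms])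
    fix T assume "T \<in> ?V"
    then have "(\<exists>m\<in>{1..<k}. T \<in> tuples n m 0) \<or> (\<exists>e. T \<in> tuples n k e)" by auto
    then obtain m e where m: "T \<in> tuples n m e" "1 \<le> m" "m \<le> k" "m < k \<longrightarrow> e \<noteq> 1"
    proof (elim disjE bexE exE)
      fix m assume "m \<in> {1..<k}" "T \<in> tuples n m 0"
      then show ?thesis by (intro that[of m 0]) auto
    next
      fix e assume "T \<in> tuples n k e"
      then show ?thesis using k2 by (intro that[of k e]) auto
    qed
    then show "reachable T" by (rule reachable_tuples)
    show "T i = {}" if "i \<notin> {1..k}" for i
      using m(2,3) that tuples_empty_iff[OF m(1), of i] by auto
  qed
  ultimately show ?thesis by linarith
qed

end

text \<open>Families of self-maps, taken as extensional functions, form a finite set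
  \<open>F\<close>; numbering it gives the letters.\<close>

lemma ex_transformation_letters:
  assumes "k \<ge> 2" and n2: "\<And>i. i \<in> {1..k} \<Longrightarrow> n i \<ge> 2"
  shows "\<exists>\<Sigma> act. transformation_letters k n \<Sigma> act"
proof -
  define F where "F = (\<Pi>\<^sub>E i\<in>{1..k}. {..<n i} \<rightarrow>\<^sub>E {..<n i})"
  have "finite F" unfolding F_def by (intro finite_PiE) auto
  then obtain act :: "nat \<Rightarrow> nat \<Rightarrow> nat \<Rightarrow> nat" where act: "bij_betw act {0..<card F} F"
    using ex_bij_betw_nat_finite[of F] by auto
  have "transformation_letters k n {0..<card F} act"
  proof (unfold_locales, goal_cases)
    case (4 a i x)
    then have "act a \<in> F" using bij_betwE[OF act] by auto
    then have "act a i \<in> {..<n i} \<rightarrow>\<^sub>E {..<n i}" using 4(2) unfolding F_def by (rule PiE_mem)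
    from PiE_mem[OF this, of x] show ?case using 4(3) by simp
  next
    case (5 h)
    define g where "g = restrict (\<lambda>i. restrict (h i) {..<n i}) {1..k}"
    have "g \<in> F" using 5 by (simp add: F_def g_def PiE_iff)
    then have "g \<in> act ` {0..<card F}" using bij_betw_imp_surj_on[OF act] by simp
    then obtain a where "a \<in> {0..<card F}" "act a = g" by auto
    then show ?case
      by (intro bexI[of _ a]) (auto simp: g_def)
  qed (use assms in auto)
  then show ?thesis by (intro exI)
qed

theorem theorem6:
  fixes k :: nat and n :: "nat \<Rightarrow> nat"
  assumes "k \<ge> 2"
    and "\<And>i. i \<in> {1..k} \<Longrightarrow> n i \<ge> 2"
  shows "\<exists>(A :: nat \<Rightarrow> (nat, nat) dfa) (\<Sigma> :: nat set).
    (\<forall>i\<in>{1..k}. is_dfa (A i) \<and> alphabet (A i) = \<Sigma> \<and> card (states (A i)) = n i) \<and>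
    (\<forall>B :: (nat, nat) dfa.
       is_dfa B \<and>
       accepted_language B = catenation_list (map (\<lambda>i. accepted_language (A i)) [1..<k + 1]) \<longrightarrow>
       int (card (states B)) \<ge>
         int (n 1) * 2 ^ (\<Sum>i = 2..k. n i) - D_term k n - (\<Sum>i = 1..k - 1. E_term k n i))"
proof -
  have "\<exists>\<Sigma> act. transformation_letters k n \<Sigma> act"
    by (rule ex_transformation_letters) (fact assms)+
  then obtain \<Sigma> act where "transformation_letters k n \<Sigma> act" by (elim exE)
  then interpret transformation_letters k n \<Sigma> act .
  show ?thesis
  proof (rule exI[of _ A], rule exI[of _ \<Sigma>], intro conjI ballI allI impI)
    fix i assume "i \<in> {1..k}"
    then show "is_dfa (A i)" by (rule is_dfa_A)
    show "alphabet (A i) = \<Sigma>" "card (states (A i)) = n i"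
      by (simp_all add: A_def)
  next
    fix B :: "(nat, nat) dfa"
    assume "is_dfa B \<and>
      accepted_language B = catenation_list (map (\<lambda>i. accepted_language (A i)) [1..<k + 1])"
    then show "int (card (states B)) \<ge>
         int (n 1) * 2 ^ (\<Sum>i = 2..k. n i) - D_term k n - (\<Sum>i = 1..k - 1. E_term k n i)"
      using states_lower_bound[of B] unfolding C_def by blast
  qed
qed

end
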